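(* Let $A$ be a triangle area number. (a) $A$ is an even integer. (b) Suppose $A\equiv 2 \pmod 4$. For any triangle with integer side lengths $a,b,c$ and area $A$, let $d,D_1,D_2,D_3,d_{12},d_{13},d_{23},k_1,k_2,k_3,k$ be the positive integers attached to it as in the context. Then $d\equiv 2\pmod 4$, and one of the following two alternatives holds: either exactly one of $d_{12},d_{13},d_{23}$ is congruent to $2$ modulo $4$, the other two of them are odd, and $k_1,k_2,k_3,k,D_1,D_2,D_3$ are all odd; or exactly one of $D_1,D_2,D_3$ is congruent to $2$ modulo $4$, the other two of them are odd, and $k_1,k_2,k_3,k,d_{12},d_{13},d_{23}$ are all odd. (c) $A$ is divisible by $3$.
   Context: A triangle area number is the area of a (nondegenerate) triangle whose sides have integer lengths and whose area is a rational number. Given a triangle with positive integer side lengths $a,b,c$ and rational area $A$, put $N_1=-a+b+c$, $N_2=a-b+c$, $N_3=a+b-c$ (positive integers), $N=a+b+c=N_1+N_2+N_3$, and $d=\gcd(N_1,N_2,N_3)$. Define $D_i=\gcd(N_i/d,\,N/d)$ for $i=1,2,3$, and $d_{ij}=\gcd(N_i/d,\,N_j/d)$ for $1\le i<j\le 3$. Then there are positive integers $M_1,M_2,M_3,M$ with $$\frac{N_1}{d}=D_1d_{12}d_{13}M_1,\quad \frac{N_2}{d}=D_2d_{12}d_{23}M_2,\quad \frac{N_3}{d}=D_3d_{13}d_{23}M_3,\quad \frac{N}{d}=D_1D_2D_3M,$$ and, because the area is rational, $M_1,M_2,M_3,M$ are perfect squares; $k_1,k_2,k_3,k$ denote the positive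 integers with $M_1=k_1^2$, $M_2=k_2^2$, $M_3=k_3^2$, $M=k^2$. *)

theory Defs
  imports "HOL-Analysis.Analysis" "HOL-Number_Theory.Cong"
begin

definition integer_triangle ::
    "real ^ 2 \<Rightarrow> real ^ 2 \<Rightarrow> real ^ 2 \<Rightarrow> int \<Rightarrow> int \<Rightarrow> int \<Rightarrow> bool" where
  "integer_triangle P Q R a b c \<longleftrightarrow>
     \<not> collinear {P, Q, R} \<and>
     dist Q R = of_int a \<and> dist P R = of_int b \<and> dist P Q = of_int c"

definition triangle_area :: "real ^ 2 \<Rightarrow> real ^ 2 \<Rightarrow> real ^ 2 \<Rightarrow> real" where
  "triangle_area P Q R = measure lborel (convex hull {P, Q, R})"

definition triangle_area_number :: "real \<Rightarrow> bool" where
  "triangle_area_number A \<longleftrightarrow>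
     A \<in> \<rat> \<and> (\<exists>P Q R a b c. integer_triangle P Q R a b c \<and> A = triangle_area P Q R)"

(* Side lengths are int rather than nat, so that -a + b + c is not truncated. *)

definition tri_N1 :: "int \<Rightarrow> int \<Rightarrow> int \<Rightarrow> int" where "tri_N1 a b c = - a + b + c"
definition tri_N2 :: "int \<Rightarrow> int \<Rightarrow> int \<Rightarrow> int" where "tri_N2 a b c = a - b + c"
definition tri_N3 :: "int \<Rightarrow> int \<Rightarrow> int \<Rightarrow> int" where "tri_N3 a b c = a + b - c"
definition tri_N :: "int \<Rightarrow> int \<Rightarrow> int \<Rightarrow> int" where "tri_N a b c = a + b + c"

definition tri_d :: "int \<Rightarrow> int \<Rightarrow> int \<Rightarrow> int" where
  "tri_d a b c = gcd (tri_N1 a b c) (gcd (tri_N2 a b c) (tri_N3 a b c))"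

(* The quotients N1/d, N2/d, N3/d, N/d; all four divisions are exact. *)

definition tri_n1 :: "int \<Rightarrow> int \<Rightarrow> int \<Rightarrow> int" where
  "tri_n1 a b c = tri_N1 a b c div tri_d a b c"
definition tri_n2 :: "int \<Rightarrow> int \<Rightarrow> int \<Rightarrow> int" where
  "tri_n2 a b c = tri_N2 a b c div tri_d a b c"
definition tri_n3 :: "int \<Rightarrow> int \<Rightarrow> int \<Rightarrow> int" where
  "tri_n3 a b c = tri_N3 a b c div tri_d a b c"
definition tri_n :: "int \<Rightarrow> int \<Rightarrow> int \<Rightarrow> int" where
  "tri_n a b c = tri_N a b c div tri_d a b c"

definition tri_D1 :: "int \<Rightarrow> int \<Rightarrow> int \<Rightarrow> int" where
  "tri_D1 a b c = gcd (tri_n1 a b c) (tri_n a b c)"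
definition tri_D2 :: "int \<Rightarrow> int \<Rightarrow> int \<Rightarrow> int" where
  "tri_D2 a b c = gcd (tri_n2 a b c) (tri_n a b c)"
definition tri_D3 :: "int \<Rightarrow> int \<Rightarrow> int \<Rightarrow> int" where
  "tri_D3 a b c = gcd (tri_n3 a b c) (tri_n a b c)"

definition tri_d12 :: "int \<Rightarrow> int \<Rightarrow> int \<Rightarrow> int" where
  "tri_d12 a b c = gcd (tri_n1 a b c) (tri_n2 a b c)"
definition tri_d13 :: "int \<Rightarrow> int \<Rightarrow> int \<Rightarrow> int" where
  "tri_d13 a b c = gcd (tri_n1 a b c) (tri_n3 a b c)"
definition tri_d23 :: "int \<Rightarrow> int \<Rightarrow> int \<Rightarrow> int" where
  "tri_d23 a b c = gcd (tri_n2 a b c) (tri_n3 a b c)"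

(* The numbers M1, M2, M3, M and their positive square roots k1, k2, k3, k are given by
   definite description. For a triangle with integer sides and rational area each of
   them exists and is unique; outside that case the values are irrelevant. *)

definition tri_M1 :: "int \<Rightarrow> int \<Rightarrow> int \<Rightarrow> int" where
  "tri_M1 a b c =
     (THE m. 0 < m \<and> tri_n1 a b c = tri_D1 a b c * tri_d12 a b c * tri_d13 a b c * m)"
definition tri_M2 :: "int \<Rightarrow> int \<Rightarrow> int \<Rightarrow> int" where
  "tri_M2 a b c =
     (THE m. 0 < m \<and> tri_n2 a b c = tri_D2 a b c * tri_d12 a b c * tri_d23 a b c * m)"
definition tri_M3 :: "int \<Rightarrow> int \<Rightarrow> int \<Rightarrow> int" where
  "tri_M3 a b c =
     (THE m. 0 < m \<and> tri_n3 a b c = tri_D3 a b c * tri_d13 a b c * tri_d23 a b c * m)"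
definition tri_M :: "int \<Rightarrow> int \<Rightarrow> int \<Rightarrow> int" where
  "tri_M a b c =
     (THE m. 0 < m \<and> tri_n a b c = tri_D1 a b c * tri_D2 a b c * tri_D3 a b c * m)"

definition tri_k1 :: "int \<Rightarrow> int \<Rightarrow> int \<Rightarrow> int" where
  "tri_k1 a b c = (THE j. 0 < j \<and> tri_M1 a b c = j\<^sup>2)"
definition tri_k2 :: "int \<Rightarrow> int \<Rightarrow> int \<Rightarrow> int" where
  "tri_k2 a b c = (THE j. 0 < j \<and> tri_M2 a b c = j\<^sup>2)"
definition tri_k3 :: "int \<Rightarrow> int \<Rightarrow> int \<Rightarrow> int" where
  "tri_k3 a b c = (THE j. 0 < j \<and> tri_M3 a b c = j\<^sup>2)"
definition tri_k :: "int \<Rightarrow> int \<Rightarrow> int \<Rightarrow> int" where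
  "tri_k a b c = (THE j. 0 < j \<and> tri_M a b c = j\<^sup>2)"

definition one_twice_odd_rest_odd :: "int \<Rightarrow> int \<Rightarrow> int \<Rightarrow> bool" where
  "one_twice_odd_rest_odd x y z \<longleftrightarrow>
     [x = 2] (mod 4) \<and> odd y \<and> odd z \<or>
     odd x \<and> [y = 2] (mod 4) \<and> odd z \<or>
     odd x \<and> odd y \<and> [z = 2] (mod 4)"

end

theory Submission
  imports Defs "HOL-Computational_Algebra.Nth_Powers"
begin

text \<open>
  By Heron's formula, \<open>(4A)\<^sup>2 = N N\<^sub>1 N\<^sub>2 N\<^sub>3\<close> with
  \<open>N = N\<^sub>1 + N\<^sub>2 + N\<^sub>3\<close>. When \<open>A\<close> is rational this is a perfect square, and everything
  comes from looking at the equation \<open>t\<^sup>2 = (x + y + z) x y z\<close> modulo small numbers: for odd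
  \<open>x, y, z\<close> the right-hand side is 3 modulo 4, and if 3 divides none of the four factors it is 2
  modulo 3; neither residue is a square. Hence 2 and 3 divide \<open>t\<close>
  (\<open>even_if_square_sum_times_prod\<close>, \<open>three_dvd_if_square_sum_times_prod\<close>).

  The residue modulo 4 also forces the \<open>N\<^sub>i\<close>, which have the same parity, to be even. So
  \<open>d = 2e\<close>, and dividing by \<open>d\<close> gives \<open>A = e\<^sup>2 t\<close>, where \<open>t\<^sup>2\<close> is the product of the
  primitive quadruple \<open>N\<^sub>1/d, N\<^sub>2/d, N\<^sub>3/d, N/d\<close> (\<open>rational_triangle_normal_form\<close>). The
  divisibility of \<open>t\<close> by 2 and by 3 proves (a) and (c).

  For (b), \<open>A \<equiv> 2\<close> modulo 4 makes \<open>e\<close> odd and \<open>t\<close> twice an odd number, so exactly two factors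
  2 are distributed over the quadruple. Since its sum \<open>2N/d\<close> is even, exactly two members are
  even, each of them twice an odd number (\<open>two_of_four_twice_odd\<close>). The gcd of these two is the
  only even one among the six pairwise gcds \<open>D\<^sub>i\<close>, \<open>d\<^sub>i\<^sub>j\<close>, and it is twice an odd number; it
  is a \<open>d\<^sub>i\<^sub>j\<close> or a \<open>D\<^sub>i\<close> according to whether \<open>N/d\<close> is odd or even, which yields the two
  alternatives. The roots \<open>k\<^sub>i, k\<close> are odd because their squares divide
  members of the quadruple, which are not divisible by 4 (\<open>odd_gcd_cofactor_root\<close>).
\<close>

section \<open>The equation $t^2 = (x + y + z)xyz$ modulo 4 and modulo 3\<close>

lemma sum_times_prod_mod_4:
  fixes x y z :: int
  assumes "odd x" "odd y" "odd z"
  shows "((x + y + z) * x * y * z) mod 4 = 3"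
proof -
  have "x mod 4 = 1 \<or> x mod 4 = 3" "y mod 4 = 1 \<or> y mod 4 = 3" "z mod 4 = 1 \<or> z mod 4 = 3"
    using assms by presburger+
  moreover have "[(x + y + z) * x * y * z =
      (x mod 4 + y mod 4 + z mod 4) * (x mod 4) * (y mod 4) * (z mod 4)] (mod 4)"
    by (intro cong_mult cong_add) (simp_all add: cong_def)
  ultimately show ?thesis by (auto simp: cong_def)
qed

lemma sum_times_prod_mod_3:
  fixes x y z :: int
  assumes "\<not> 3 dvd x" "\<not> 3 dvd y" "\<not> 3 dvd z" "\<not> 3 dvd x + y + z"
  shows "((x + y + z) * x * y * z) mod 3 = 2"
proof -
  have "x mod 3 = 1 \<or> x mod 3 = 2" "y mod 3 = 1 \<or> y mod 3 = 2" "z mod 3 = 1 \<or> z mod 3 = 2"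
    using assms(1-3) by presburger+
  moreover have "(x mod 3 + y mod 3 + z mod 3) mod 3 \<noteq> 0"
    using assms(4) by presburger
  moreover have "[(x + y + z) * x * y * z =
      (x mod 3 + y mod 3 + z mod 3) * (x mod 3) * (y mod 3) * (z mod 3)] (mod 3)"
    by (intro cong_mult cong_add) (simp_all add: cong_def)
  ultimately show ?thesis by (auto simp: cong_def)
qed

lemma square_mod_4: "(t::int)\<^sup>2 mod 4 \<noteq> 3"
proof -
  have "t mod 4 = 0 \<or> t mod 4 = 1 \<or> t mod 4 = 2 \<or> t mod 4 = 3" by presburger
  moreover have "t\<^sup>2 mod 4 = (t mod 4)\<^sup>2 mod 4" by (simp add: power_mod)
  ultimately show ?thesis by auto
qed

lemma square_mod_3: "(t::int)\<^sup>2 mod 3 \<noteq> 2"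
proof -
  have "t mod 3 = 0 \<or> t mod 3 = 1 \<or> t mod 3 = 2" by presburger
  moreover have "t\<^sup>2 mod 3 = (t mod 3)\<^sup>2 mod 3" by (simp add: power_mod)
  ultimately show ?thesis by auto
qed

text \<open>
  If \<open>t\<close> is odd then so are \<open>x\<close>, \<open>y\<close> and \<open>z\<close>, and the product is 3 modulo 4, which no square is.
\<close>

lemma even_if_square_sum_times_prod:
  fixes t x y z :: int
  assumes "t\<^sup>2 = (x + y + z) * x * y * z"
  shows "even t"
proof (rule ccontr)
  assume "odd t"
  hence "odd (t\<^sup>2)" by simp
  hence "odd x" "odd y" "odd z" unfolding assms by auto
  thus False using sum_times_prod_mod_4 square_mod_4 assms by metis
qed

lemma three_dvd_if_square_sum_times_prod:
  fixes t x y z :: int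
  assumes "t\<^sup>2 = (x + y + z) * x * y * z"
  shows "3 dvd t"
proof -
  have "3 dvd (x + y + z) * x * y * z"
    using sum_times_prod_mod_3 square_mod_3 assms by (metis dvd_mult dvd_mult2)
  hence "3 dvd t\<^sup>2" by (simp only: assms)
  thus ?thesis by (intro prime_dvd_power[of 3 t 2]) auto
qed

section \<open>Squares and cofactors of pairwise gcds\<close>

lemma rational_sqrt_int:
  fixes q :: real
  assumes "q \<in> \<rat>" "q\<^sup>2 = of_int m"
  obtains n :: int where "q = of_int n"
proof -
  from assms(1) obtain i j :: int where ij: "j \<noteq> 0" "q = of_int i / of_int j"
    by (metis Rats_cases' less_irrefl)
  hence "of_int (i\<^sup>2) = (of_int (m * j\<^sup>2) :: real)"
    using assms(2) by (simp add: power_divide divide_eq_eq)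
  hence "i\<^sup>2 = m * j\<^sup>2" by (simp only: of_int_eq_iff)
  hence "j\<^sup>2 dvd i\<^sup>2" by simp
  hence "j dvd i" by simp
  then obtain n where "i = j * n" ..
  with ij have "q = of_int n" by simp
  thus ?thesis by (rule that)
qed

lemma square_if_coprime_mult_square:
  fixes m r u :: int
  assumes "coprime m r" "m > 0" "r > 0" "m * r = u\<^sup>2"
  obtains k where "k > 0" "m = k\<^sup>2"
proof -
  have "nat m * nat r = (nat \<bar>u\<bar>)\<^sup>2"
    using assms(2,3) by (simp add: assms(4) nat_mult_distrib [symmetric] nat_power_eq [symmetric])
  hence "is_nth_power 2 (nat m * nat r)" by (rule is_nth_powerI)
  moreover have "coprime (nat m) (nat r)"
    using assms(1-3) by (simp add: coprime_int_iff [symmetric])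
  ultimately have "is_nth_power 2 (nat m)"
    using assms(2,3) by (intro is_nth_power_mult_coprime_natD(1)[of "nat m" "nat r"]) auto
  then obtain k where "nat m = k\<^sup>2" by (elim is_nth_powerE)
  hence "m = (int k)\<^sup>2" using assms(2) by (metis int_nat_eq less_imp_le of_nat_power)
  moreover have "int k > 0" using calculation assms(2) by (cases k) auto
  ultimately show ?thesis by (intro that)
qed

text \<open>
  The reason why the numbers \<open>M\<^sub>i\<close> and \<open>M\<close> exist and are perfect squares, proved for one member
  \<open>w\<close> of the quadruple. As no prime divides \<open>w\<close> and two further members, its three gcds are
  pairwise coprime and their product divides \<open>w\<close>. Removing from \<open>w x y z\<close> the square of that
  product leaves the cofactor of \<open>w\<close> times the cofactors \<open>x / gcd w x\<close>, \<open>y / gcd w y\<close> and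
  \<open>z / gcd w z\<close>. The first is coprime to each of the others, so it is itself a square.
\<close>

lemma gcd_cofactor_is_square:
  fixes w x y z t :: int
  assumes pos: "w > 0" "x > 0" "y > 0" "z > 0"
    and prim: "gcd w (gcd x y) = 1" "gcd w (gcd x z) = 1" "gcd w (gcd y z) = 1"
    and sq: "w * x * y * z = t\<^sup>2"
  obtains k where "k > 0" "w = gcd w x * gcd w y * gcd w z * k\<^sup>2"
proof -
  define gx gy gz where g_def: "gx = gcd w x" "gy = gcd w y" "gz = gcd w z"
  have gpos: "gx > 0" "gy > 0" "gz > 0" using pos by (simp_all add: g_def)
  have copg: "coprime (gcd w u) (gcd w v)" if "gcd w (gcd u v) = 1" for u v
  proof (rule coprimeI)
    fix c assume "c dvd gcd w u" "c dvd gcd w v"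
    hence "c dvd gcd w (gcd u v)" by simp
    thus "is_unit c" using that by simp
  qed
  have "coprime gx gy" "coprime gx gz" "coprime gy gz"
    unfolding g_def by (intro copg prim)+
  hence "gx * gy * gz dvd w"
    by (intro divides_mult) (simp_all add: g_def)
  then obtain m where m: "w = gx * gy * gz * m" ..
  obtain x' where x': "x = gx * x'" using g_def(1) gcd_dvd2 by blast
  obtain y' where y': "y = gy * y'" using g_def(2) gcd_dvd2 by blast
  obtain z' where z': "z = gz * z'" using g_def(3) gcd_dvd2 by blast
  have "gx * gy * gz > 0" using gpos by simp
  moreover have "gx * gy * gz * m > 0" unfolding m [symmetric] by (fact pos)
  ultimately have mpos: "m > 0" by (metis zero_less_mult_pos)
  have "gx * x' > 0" "gy * y' > 0" "gz * z' > 0"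
    unfolding x' [symmetric] y' [symmetric] z' [symmetric] by (fact pos)+
  hence pos': "x' > 0" "y' > 0" "z' > 0" using gpos by (metis zero_less_mult_pos)+
  have cop: "coprime m v'" if "v = g * v'" "w = g * (h * m)" "g = gcd w v" "g > 0" for v v' g h
  proof -
    have "gcd (g * (h * m)) (g * v') = g" by (simp only: that(1-3) [symmetric])
    hence "g * gcd (h * m) v' = g"
      using that(4) by (simp only: gcd_mult_distrib_int [symmetric] abs_of_pos)
    hence "coprime (h * m) v'" using that(4) by (simp add: coprime_iff_gcd_eq_1)
    thus ?thesis by simp
  qed
  have "coprime m x'"
    by (rule cop[OF x' _ g_def(1) gpos(1), of "gy * gz"]) (simp only: m mult_ac)
  moreover have "coprime m y'"
    by (rule cop[OF y' _ g_def(2) gpos(2), of "gx * gz"]) (simp only: m mult_ac)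
  moreover have "coprime m z'"
    by (rule cop[OF z' _ g_def(3) gpos(3), of "gx * gy"]) (simp only: m mult_ac)
  ultimately have co: "coprime m (x' * y' * z')" by simp
  have eq: "(gx * gy * gz)\<^sup>2 * (m * (x' * y' * z')) = t\<^sup>2"
    unfolding sq [symmetric] x' y' z' m by (simp add: power2_eq_square mult_ac)
  hence "(gx * gy * gz)\<^sup>2 dvd t\<^sup>2" by (metis dvd_triv_left)
  hence "gx * gy * gz dvd t" by simp
  then obtain u where "t = gx * gy * gz * u" ..
  with eq gpos have "m * (x' * y' * z') = u\<^sup>2" by (simp add: power_mult_distrib)
  with co mpos pos' obtain k where "k > 0" "m = k\<^sup>2"
    by (elim square_if_coprime_mult_square) auto
  from m have "w = gcd w x * gcd w y * gcd w z * k\<^sup>2"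
    unfolding \<open>m = k\<^sup>2\<close> g_def .
  with \<open>k > 0\<close> show ?thesis by (rule that)
qed

text \<open>
  The two descriptions are those that define \<open>tri_M\<close> and \<open>tri_k\<close> and their indexed variants;
  they pick out the root found above, and \<open>k\<^sup>2\<close> divides \<open>w\<close>, so an even \<open>k\<close> would make 4 divide \<open>w\<close>.
\<close>

lemma odd_gcd_cofactor_root:
  fixes w x y z t :: int
  assumes pos: "w > 0" "x > 0" "y > 0" "z > 0"
    and prim: "gcd w (gcd x y) = 1" "gcd w (gcd x z) = 1" "gcd w (gcd y z) = 1"
    and sq: "w * x * y * z = t\<^sup>2"
    and "\<not> 4 dvd w"
  shows "odd (THE j. 0 < j \<and> (THE m. 0 < m \<and> w = gcd w x * gcd w y * gcd w z * m) = j\<^sup>2)"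
proof -
  obtain k where k: "k > 0" "w = gcd w x * gcd w y * gcd w z * k\<^sup>2"
    using gcd_cofactor_is_square[OF pos prim sq] .
  have "(THE m. 0 < m \<and> w = gcd w x * gcd w y * gcd w z * m) = k\<^sup>2"
  proof (rule the_equality)
    fix m assume "0 < m \<and> w = gcd w x * gcd w y * gcd w z * m"
    hence "gcd w x * gcd w y * gcd w z * m = gcd w x * gcd w y * gcd w z * k\<^sup>2"
      using k(2) by simp
    thus "m = k\<^sup>2" using pos by simp
  qed (use k in auto)
  moreover have "(THE j. 0 < j \<and> k\<^sup>2 = j\<^sup>2) = k"
    by (rule the_equality) (use k(1) in \<open>auto simp: power2_eq_iff\<close>)
  moreover have "odd k"
  proof
    assume "even k"
    then obtain l where "k = 2 * l" ..
    hence "w = 4 * (gcd w x * gcd w y * gcd w z * l\<^sup>2)"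
      using k(2) by (simp add: power_mult_distrib)
    thus False using \<open>\<not> 4 dvd w\<close> by (metis dvd_triv_left)
  qed
  ultimately show ?thesis by simp
qed

text \<open>
  The product \<open>t\<^sup>2\<close> contains exactly two factors 2, and an even sum means that the number of even
  members is 0, 2 or 4. It is not 0, as \<open>t\<close> is even, and not 4, as 16 does not divide \<open>t\<^sup>2\<close>; so it
  is 2, with one factor 2 in each. The last two conclusions say that among three members there
  are both parities. The hypotheses are symmetric in the four members, so instantiating these
  conclusions at permutations gives the complete pattern.
\<close>

lemma two_of_four_twice_odd:
  fixes t w x y z :: int
  assumes "t\<^sup>2 = w * x * y * z" "even (w + x + y + z)" "even t" "\<not> 4 dvd t"
  shows "\<not> 4 dvd w"
    and "even w \<Longrightarrow> even x \<Longrightarrow> odd y"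
    and "odd w \<Longrightarrow> odd x \<Longrightarrow> even y"
proof -
  obtain u where u: "t = 2 * u" using \<open>even t\<close> ..
  with \<open>\<not> 4 dvd t\<close> have "odd u" by auto
  have n8: "\<not> 8 dvd w * x * y * z"
  proof
    assume "8 dvd w * x * y * z"
    hence "4 * 2 dvd 4 * u\<^sup>2" unfolding assms(1) [symmetric] u by (simp add: power_mult_distrib)
    hence "even (u\<^sup>2)" by (subst (asm) dvd_mult_cancel_left) auto
    with \<open>odd u\<close> show False by simp
  qed
  show "\<not> 4 dvd w"
  proof
    assume "4 dvd w"
    hence "even w" by presburger
    with assms(2) have "even (x * y * z)" by auto
    with \<open>4 dvd w\<close> have "4 * 2 dvd w * (x * y * z)" by (rule mult_dvd_mono)
    with n8 show False by (simp add: mult_ac)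
  qed
  show "odd y" if "even w" "even x"
  proof
    assume "even y"
    with that have "2 * 2 * 2 dvd w * x * y" by (intro mult_dvd_mono)
    with n8 show False by simp
  qed
  show "even y" if "odd w" "odd x"
  proof (rule ccontr)
    assume "odd y"
    with that assms(2) have "odd z" by auto
    with that \<open>odd y\<close> have "odd (t\<^sup>2)" unfolding assms(1) by simp
    with \<open>even t\<close> show False by simp
  qed
qed

lemma gcd_sum_eq_1:
  fixes x y z :: int
  assumes "gcd x (gcd y z) = 1"
  shows "gcd (x + y + z) (gcd x y) = 1"
proof -
  define g where "g = gcd (x + y + z) (gcd x y)"
  have g: "g dvd x + y + z" "g dvd x" "g dvd y" unfolding g_def by (auto intro: dvd_trans)
  hence "g dvd (x + y + z) - x - y" by (intro dvd_diff)
  hence "g dvd gcd x (gcd y z)" using g(2,3) by simp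
  hence "\<bar>g\<bar> = 1" unfolding assms by (simp only: zdvd1_eq)
  thus ?thesis by (simp add: g_def)
qed

section \<open>From a triangle to the primitive quadruple\<close>

lemma cong_2_mod_4_iff: "[x = 2] (mod 4) \<longleftrightarrow> even x \<and> \<not> 4 dvd x" for x :: int
  by (simp add: cong_def) presburger

lemma not_four_dvd_gcd: "\<not> 4 dvd x \<Longrightarrow> \<not> 4 dvd gcd x y" for x y :: int
  by (meson dvd_trans gcd_dvd1)

text \<open>
  Equality in one of the triangle inequalities would put a vertex between the other two.
\<close>

lemma integer_triangle_pos:
  assumes "integer_triangle P Q R a b c"
  shows "tri_N1 a b c > 0" "tri_N2 a b c > 0" "tri_N3 a b c > 0"
proof -
  have nb: "\<not> between (Q, R) P" "\<not> between (R, P) Q" "\<not> between (P, Q) R"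
    and d: "dist Q R = of_int a" "dist P R = of_int b" "dist P Q = of_int c"
    using assms by (simp_all add: integer_triangle_def collinear_between_cases)
  have "dist Q R < dist P Q + dist P R" "dist P R < dist Q R + dist P Q"
    "dist P Q < dist P R + dist Q R"
    using nb dist_triangle[of Q R P] dist_triangle[of P R Q] dist_triangle[of P Q R]
    by (auto simp: between dist_commute)
  hence "of_int a < (of_int (c + b) :: real)" "of_int b < (of_int (a + c) :: real)"
    "of_int c < (of_int (b + a) :: real)"
    by (simp_all add: d)
  thus "tri_N1 a b c > 0" "tri_N2 a b c > 0" "tri_N3 a b c > 0"
    unfolding of_int_less_iff tri_N1_def tri_N2_def tri_N3_def by linarith+
qed

lemma integer_triangle_heron:
  assumes "integer_triangle P Q R a b c"
  shows "(4 * triangle_area P Q R)\<^sup>2 =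
    of_int (tri_N a b c * tri_N1 a b c * tri_N2 a b c * tri_N3 a b c)"
proof -
  have d: "dist Q R = of_int a" "dist P R = of_int b" "dist P Q = of_int c"
    using assms by (simp_all add: integer_triangle_def)
  define p where "p = of_int (tri_N a b c * tri_N1 a b c * tri_N2 a b c * tri_N3 a b c) / (16::real)"
  have "tri_N a b c = tri_N1 a b c + tri_N2 a b c + tri_N3 a b c"
    by (simp add: tri_N_def tri_N1_def tri_N2_def tri_N3_def)
  hence "p \<ge> 0" using integer_triangle_pos[OF assms] by (simp add: p_def)
  have "triangle_area P Q R = sqrt p"
    unfolding triangle_area_def heron d p_def
    by (simp add: tri_N_def tri_N1_def tri_N2_def tri_N3_def field_simps)
  hence "(triangle_area P Q R)\<^sup>2 = p" using \<open>p \<ge> 0\<close> by simp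
  thus ?thesis unfolding p_def by (simp add: power_mult_distrib)
qed

text \<open>
  The three numbers have the same parity, and they are not all odd since their product with
  their sum is the square \<open>(4A)\<^sup>2\<close>.
\<close>

lemma rational_triangle_even_N:
  assumes T: "integer_triangle P Q R a b c" and "triangle_area P Q R \<in> \<rat>"
  shows "even (tri_N1 a b c)" "even (tri_N2 a b c)" "even (tri_N3 a b c)"
proof -
  let ?x = "tri_N1 a b c" and ?y = "tri_N2 a b c" and ?z = "tri_N3 a b c"
  have N: "tri_N a b c = ?x + ?y + ?z"
    by (simp add: tri_N_def tri_N1_def tri_N2_def tri_N3_def)
  have "4 * triangle_area P Q R \<in> \<rat>" using assms(2) by simp
  then obtain m :: int where "4 * triangle_area P Q R = of_int m"
    using integer_triangle_heron[OF T] by (rule rational_sqrt_int)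
  with integer_triangle_heron[OF T]
  have "of_int (m\<^sup>2) = (of_int (tri_N a b c * ?x * ?y * ?z) :: real)" by simp
  hence m: "m\<^sup>2 = (?x + ?y + ?z) * ?x * ?y * ?z" by (simp only: of_int_eq_iff N)
  have "even ?x \<or> even ?y \<or> even ?z"
    using sum_times_prod_mod_4 square_mod_4 m by metis
  moreover have "even (?x + ?y)" "even (?y + ?z)"
    by (simp_all add: tri_N1_def tri_N2_def tri_N3_def)
  ultimately show "even ?x" "even ?y" "even ?z" by auto
qed

text \<open>
  With \<open>d = 2e\<close> the factor 16 in \<open>16 A\<^sup>2 = N N\<^sub>1 N\<^sub>2 N\<^sub>3\<close> cancels against \<open>d\<^sup>4 = 16 e\<^sup>4\<close>, so the
  rational number \<open>t = A / e\<^sup>2\<close> has an integer square and is an integer.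
\<close>

lemma rational_triangle_normal_form:
  assumes T: "integer_triangle P Q R a b c" and "triangle_area P Q R \<in> \<rat>"
  obtains e t :: int where
    "tri_d a b c = 2 * e"
    "triangle_area P Q R = of_int (e\<^sup>2 * t)"
    "t\<^sup>2 = (tri_n1 a b c + tri_n2 a b c + tri_n3 a b c) * tri_n1 a b c * tri_n2 a b c * tri_n3 a b c"
    "tri_n a b c = tri_n1 a b c + tri_n2 a b c + tri_n3 a b c"
    "tri_n1 a b c > 0" "tri_n2 a b c > 0" "tri_n3 a b c > 0"
    "gcd (tri_n1 a b c) (gcd (tri_n2 a b c) (tri_n3 a b c)) = 1"
proof -
  define x y z d n1 n2 n3 where defs: "x = tri_N1 a b c" "y = tri_N2 a b c" "z = tri_N3 a b c"
    "d = tri_d a b c" "n1 = tri_n1 a b c" "n2 = tri_n2 a b c" "n3 = tri_n3 a b c"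
  have pos: "x > 0" "y > 0" "z > 0" unfolding defs using integer_triangle_pos[OF T] by auto
  have ev: "even x" "even y" "even z" unfolding defs using rational_triangle_even_N[OF assms] by auto
  have d: "d = gcd x (gcd y z)" by (simp add: defs tri_d_def)
  have "d > 0" using pos by (simp add: d)
  have "d dvd x" "d dvd y" "d dvd z" by (auto simp: d intro: dvd_trans)
  hence n: "x = d * n1" "y = d * n2" "z = d * n3"
    by (simp_all add: defs tri_n1_def tri_n2_def tri_n3_def)
  have N: "tri_N a b c = x + y + z"
    by (simp add: defs tri_N_def tri_N1_def tri_N2_def tri_N3_def)
  have "tri_n a b c = (d * (n1 + n2 + n3)) div d"
    unfolding tri_n_def N by (simp add: n distrib_left defs(4))
  hence nsum: "tri_n a b c = n1 + n2 + n3" using \<open>d > 0\<close> by simp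
  have npos: "n1 > 0" "n2 > 0" "n3 > 0"
    using pos \<open>d > 0\<close> by (simp_all add: n zero_less_mult_iff)
  have "gcd x (gcd y z) = d * gcd n1 (gcd n2 n3)"
    unfolding n using \<open>d > 0\<close> by (simp add: gcd_mult_distrib_int [symmetric])
  hence "d * gcd n1 (gcd n2 n3) = d * 1" using d by simp
  hence prim: "gcd n1 (gcd n2 n3) = 1" using \<open>d > 0\<close> by simp
  have "even d" using ev by (simp add: d)
  then obtain e where e: "d = 2 * e" ..
  with \<open>d > 0\<close> have "e > 0" by simp
  define q where "q = triangle_area P Q R / of_int (e\<^sup>2)"
  have A: "triangle_area P Q R = of_int (e\<^sup>2) * q" using \<open>e > 0\<close> by (simp add: q_def)
  have "q \<in> \<rat>" using assms(2) by (auto simp: q_def simp del: of_int_power)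
  have "(4 * of_int (e\<^sup>2) * q)\<^sup>2 = of_int ((x + y + z) * x * y * z)"
    using integer_triangle_heron[OF T] unfolding N defs(1-3) [symmetric] by (simp add: A mult_ac)
  also have "(x + y + z) * x * y * z = (4 * e\<^sup>2)\<^sup>2 * ((n1 + n2 + n3) * n1 * n2 * n3)"
    unfolding n e by algebra
  finally have "q\<^sup>2 = of_int ((n1 + n2 + n3) * n1 * n2 * n3)"
    using \<open>e > 0\<close> by (simp add: power_mult_distrib)
  with \<open>q \<in> \<rat>\<close> obtain t :: int where t: "q = of_int t" by (rule rational_sqrt_int)
  with \<open>q\<^sup>2 = _\<close> have "of_int (t\<^sup>2) = (of_int ((n1 + n2 + n3) * n1 * n2 * n3) :: real)" by simp
  hence "t\<^sup>2 = (n1 + n2 + n3) * n1 * n2 * n3" by (simp only: of_int_eq_iff)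
  moreover have "triangle_area P Q R = of_int (e\<^sup>2 * t)" by (simp add: A t)
  ultimately show ?thesis
    using e nsum npos prim unfolding defs by (intro that) auto
qed

section \<open>The 2-adic pattern and the main result\<close>

text \<open>
  Both parities occur among \<open>w, x, y\<close> and among \<open>x, y, z\<close>; together with the even sum this leaves
  exactly the six ways of choosing two even members, one for each of the six gcds.
\<close>

lemma triangle_parity_pattern:
  assumes T: "integer_triangle P Q R a b c"
    and A: "triangle_area P Q R = of_int m" and m: "[m = 2] (mod 4)"
  shows "[tri_d a b c = 2] (mod 4) \<and>
         (one_twice_odd_rest_odd (tri_d12 a b c) (tri_d13 a b c) (tri_d23 a b c) \<and>
            odd (tri_k1 a b c) \<and> odd (tri_k2 a b c) \<and> odd (tri_k3 a b c) \<and> odd (tri_k a b c) \<and>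
            odd (tri_D1 a b c) \<and> odd (tri_D2 a b c) \<and> odd (tri_D3 a b c)
          \<or>
          one_twice_odd_rest_odd (tri_D1 a b c) (tri_D2 a b c) (tri_D3 a b c) \<and>
            odd (tri_k1 a b c) \<and> odd (tri_k2 a b c) \<and> odd (tri_k3 a b c) \<and> odd (tri_k a b c) \<and>
            odd (tri_d12 a b c) \<and> odd (tri_d13 a b c) \<and> odd (tri_d23 a b c))"
proof -
  define x y z w where defs: "x = tri_n1 a b c" "y = tri_n2 a b c" "z = tri_n3 a b c"
    "w = tri_n a b c"
  have "triangle_area P Q R \<in> \<rat>" by (simp add: A)
  from rational_triangle_normal_form[OF T this] obtain e t where et: "tri_d a b c = 2 * e"
    "triangle_area P Q R = of_int (e\<^sup>2 * t)" "t\<^sup>2 = (x + y + z) * x * y * z" "w = x + y + z"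
    and pos: "x > 0" "y > 0" "z > 0" and prim: "gcd x (gcd y z) = 1"
    unfolding defs .
  have "m = e\<^sup>2 * t" using et(2) A by (simp only: of_int_eq_iff)
  have "even t" using et(3) by (rule even_if_square_sum_times_prod)
  have "\<not> 4 dvd m" using m by (simp add: cong_2_mod_4_iff)
  hence "\<not> 4 dvd t" unfolding \<open>m = _\<close> by auto
  have "odd e"
  proof
    assume "even e"
    then obtain f where "e = 2 * f" ..
    hence "m = 4 * (f\<^sup>2 * t)" using \<open>m = _\<close> by (simp add: power_mult_distrib)
    with \<open>\<not> 4 dvd m\<close> show False by simp
  qed
  hence d: "[tri_d a b c = 2] (mod 4)" unfolding et(1) cong_2_mod_4_iff by presburger
  have "w > 0" using pos et(4) by simp
  have sq: "w * x * y * z = t\<^sup>2" by (simp add: et(3,4))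
  have ev: "even (w + x + y + z)" by (simp add: et(4))
  note two = two_of_four_twice_odd[OF _ _ \<open>even t\<close> \<open>\<not> 4 dvd t\<close>]
  have sqs: "t\<^sup>2 = w * x * y * z" "t\<^sup>2 = x * w * y * z" "t\<^sup>2 = y * w * x * z" "t\<^sup>2 = z * w * x * y"
    "t\<^sup>2 = x * y * z * w"
    unfolding sq [symmetric] by (simp_all add: mult_ac)
  have evs: "even (w + x + y + z)" "even (x + w + y + z)" "even (y + w + x + z)"
    "even (z + w + x + y)" "even (x + y + z + w)"
    using ev by (simp_all add: add_ac)
  have n4: "\<not> 4 dvd w" "\<not> 4 dvd x" "\<not> 4 dvd y" "\<not> 4 dvd z"
    using two(1)[OF sqs(1) evs(1)] two(1)[OF sqs(2) evs(2)] two(1)[OF sqs(3) evs(3)]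
      two(1)[OF sqs(4) evs(4)] by blast+
  have par: "even w \<and> even x \<and> odd y \<and> odd z \<or> even w \<and> odd x \<and> even y \<and> odd z \<or>
      even w \<and> odd x \<and> odd y \<and> even z \<or> odd w \<and> even x \<and> even y \<and> odd z \<or>
      odd w \<and> even x \<and> odd y \<and> even z \<or> odd w \<and> odd x \<and> even y \<and> even z"
    using two(2,3)[OF sqs(1) evs(1)] two(2,3)[OF sqs(5) evs(5)] ev
    unfolding even_add by blast
  have prims: "gcd w (gcd x y) = 1" "gcd w (gcd x z) = 1" "gcd w (gcd y z) = 1"
    using gcd_sum_eq_1[of x y z] gcd_sum_eq_1[of x z y] gcd_sum_eq_1[of y z x] prim
    by (simp_all add: et(4) ac_simps)
  have prims_perm: "gcd x (gcd w y) = 1" "gcd x (gcd w z) = 1" "gcd y (gcd w x) = 1" "gcd y (gcd w z) = 1"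
    "gcd y (gcd x z) = 1" "gcd z (gcd w x) = 1" "gcd z (gcd w y) = 1" "gcd z (gcd x y) = 1"
    using prim prims by (simp_all add: ac_simps)
  have G: "tri_d12 a b c = gcd x y" "tri_d13 a b c = gcd x z" "tri_d23 a b c = gcd y z"
    "tri_D1 a b c = gcd x w" "tri_D2 a b c = gcd y w" "tri_D3 a b c = gcd z w"
    by (simp_all add: tri_d12_def tri_d13_def tri_d23_def tri_D1_def tri_D2_def tri_D3_def defs)
  have k: "odd (tri_k a b c)" "odd (tri_k1 a b c)" "odd (tri_k2 a b c)" "odd (tri_k3 a b c)"
    unfolding tri_k_def tri_k1_def tri_k2_def tri_k3_def
      tri_M_def tri_M1_def tri_M2_def tri_M3_def G defs [symmetric]
    using odd_gcd_cofactor_root[OF \<open>w > 0\<close> pos prims sq n4(1)]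
      odd_gcd_cofactor_root[OF pos(1) \<open>w > 0\<close> pos(2,3) prims_perm(1,2) prim sqs(2)[symmetric] n4(2)]
      odd_gcd_cofactor_root[OF pos(2) \<open>w > 0\<close> pos(1,3) prims_perm(3-5) sqs(3)[symmetric] n4(3)]
      odd_gcd_cofactor_root[OF pos(3) \<open>w > 0\<close> pos(1,2) prims_perm(6-8) sqs(4)[symmetric] n4(4)]
    by (simp_all only: gcd.commute[of w] gcd.commute[of y x] gcd.commute[of z x] gcd.commute[of z y]
        not_False_eq_True)
  show ?thesis
    unfolding one_twice_odd_rest_odd_def G cong_2_mod_4_iff
    using d k par n4 by (auto simp: cong_2_mod_4_iff not_four_dvd_gcd)
qed

theorem mainTheorem2:
  fixes A :: real
  assumes "triangle_area_number A"
  shows "(\<exists>n::int. A = of_int n \<and> even n) \<and>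
    ((\<exists>n::int. A = of_int n \<and> [n = 2] (mod 4)) \<longrightarrow>
      (\<forall>P Q R a b c. integer_triangle P Q R a b c \<and> triangle_area P Q R = A \<longrightarrow>
         [tri_d a b c = 2] (mod 4) \<and>
         (one_twice_odd_rest_odd (tri_d12 a b c) (tri_d13 a b c) (tri_d23 a b c) \<and>
            odd (tri_k1 a b c) \<and> odd (tri_k2 a b c) \<and> odd (tri_k3 a b c) \<and> odd (tri_k a b c) \<and>
            odd (tri_D1 a b c) \<and> odd (tri_D2 a b c) \<and> odd (tri_D3 a b c)
          \<or>
          one_twice_odd_rest_odd (tri_D1 a b c) (tri_D2 a b c) (tri_D3 a b c) \<and>
            odd (tri_k1 a b c) \<and> odd (tri_k2 a b c) \<and> odd (tri_k3 a b c) \<and> odd (tri_k a b c) \<and>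
            odd (tri_d12 a b c) \<and> odd (tri_d13 a b c) \<and> odd (tri_d23 a b c)))) \<and>
    (\<exists>n::int. A = of_int n \<and> 3 dvd n)"
proof -
  from assms obtain P Q R a b c where T: "integer_triangle P Q R a b c"
    and A: "A = triangle_area P Q R" and rat: "A \<in> \<rat>"
    unfolding triangle_area_number_def by blast
  obtain e t where et: "A = of_int (e\<^sup>2 * t)" "t\<^sup>2 =
      (tri_n1 a b c + tri_n2 a b c + tri_n3 a b c) * tri_n1 a b c * tri_n2 a b c * tri_n3 a b c"
    using rational_triangle_normal_form[OF T] rat unfolding A by metis
  have "even (e\<^sup>2 * t)" using even_if_square_sum_times_prod[OF et(2)] by simp
  moreover have "3 dvd e\<^sup>2 * t" using three_dvd_if_square_sum_times_prod[OF et(2)] by simp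
  ultimately show ?thesis using et(1) triangle_parity_pattern by blast
qed

end
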